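(* Let $\Gamma$ be a countable group and let $P \subset \mathbb{R}$ be a closed subset such that $\mathbb{R}$ acts freely on the hull $\Omega_P$. If $\varphi : \Gamma \to \mathbb{R}$ is a quasimorphism with $\varphi(e) = 0$ which is not at bounded distance from a homomorphism $\Gamma \to \mathbb{R}$, then the orbit closure $\Omega_{P(\varphi)}$ of the twisted set $P(\varphi) \subset \Gamma \times \mathbb{R}$ does not admit a $(\Gamma \times \mathbb{R})$-invariant Borel probability measure.
   Context: A function $\varphi:\Gamma\to\mathbb{R}$ is a quasimorphism if $\sup_{g,h\in\Gamma}|\varphi(gh)-\varphi(g)-\varphi(h)|<\infty$. Two functions $\varphi_1,\varphi_2$ on $\Gamma$ are at bounded distance if $\|\varphi_1-\varphi_2\|_\infty<\infty$. The group $\Gamma$ is discrete. For a closed set $P\subset\mathbb{R}$, the $\varphi$-twist of $P$ is $P(\varphi) := \{(\gamma,t)\in\Gamma\times\mathbb{R} \mid \varphi(\gamma)+t\in P\}$, a closed subset of $\Gamma\times\mathbb{R}$. For a locally compact second countable group $G$, $\mathscr{C}(G)$ denotes the space of closed subsets of $G$ with the Chabauty-Fell topology (a compact metrizable space), with $G$-action $g.Q := Qg^{-1}$ (so $t.Q=Q-t$ for $G=\mathbb{R}$). For a closed subset $Q\subset G$, the hull $\Omega_Q\subset\mathscr{C}(G)$ is the closure of the $G$-orbit of $Q$. Here $\Omega_P\subset\mathscr{C}(\mathbb{R})$ and $\Omega_{P(\varphi)}\subset\mathscr{C}(\Gamma\times\mathbb{R})$. *)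

theory Defs
  imports "HOL-Probability.Probability" "HOL-Algebra.Elementary_Groups"
begin

definition real_group :: "real monoid"
  where "real_group = \<lparr>carrier = UNIV, monoid.mult = (+), one = 0\<rparr>"

lemma real_group_simps [simp]:
  "carrier real_group = UNIV" "monoid.mult real_group = (+)" "one real_group = 0"
  by (simp_all add: real_group_def)

lemma group_real_group [simp]: "group real_group"
proof (rule groupI)
  fix x assume "x \<in> carrier real_group"
  show "\<exists>y\<in>carrier real_group. y \<otimes>\<^bsub>real_group\<^esub> x = \<one>\<^bsub>real_group\<^esub>"
    by (rule bexI [of _ "- x"]) simp_all
qed auto

lemma inv_real_group [simp]: "inv\<^bsub>real_group\<^esub> x = - x"
  by (rule group.inv_equality) auto

text \<open>The points are the closed subsets of \<open>X\<close>; a subbasis of the open sets consists of the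
  families of closed sets missing a given compact set or hitting a given open set.\<close>

definition chabauty_fell :: "'a topology \<Rightarrow> 'a set topology"
  where "chabauty_fell X = topology_generated_by
    ({{C. closedin X C \<and> C \<inter> K = {}} | K. compactin X K} \<union>
     {{C. closedin X C \<and> C \<inter> U \<noteq> {}} | U. openin X U})"

lemma topspace_chabauty_fell: "topspace (chabauty_fell X) = {C. closedin X C}"
proof
  show "topspace (chabauty_fell X) \<subseteq> {C. closedin X C}"
    by (auto simp: chabauty_fell_def)
  have "{C. closedin X C} = {C. closedin X C \<and> C \<inter> {} = {}}"
    by simp
  moreover have "compactin X {}"
    by simp
  ultimately show "{C. closedin X C} \<subseteq> topspace (chabauty_fell X)"
    unfolding chabauty_fell_def topology_generated_by_topspace by blast
qed

definition translate :: "('a, 'b) monoid_scheme \<Rightarrow> 'a \<Rightarrow> 'a set \<Rightarrow> 'a set"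
  where "translate G g Q = (\<lambda>q. q \<otimes>\<^bsub>G\<^esub> inv\<^bsub>G\<^esub> g) ` Q"

text \<open>In \<^term>\<open>orbit_hull G X Q\<close>, the topology \<open>X\<close> is the group topology on the carrier of \<open>G\<close>.\<close>

definition orbit_hull :: "('a, 'b) monoid_scheme \<Rightarrow> 'a topology \<Rightarrow> 'a set \<Rightarrow> 'a set set"
  where "orbit_hull G X Q = chabauty_fell X closure_of ((\<lambda>g. translate G g Q) ` carrier G)"

definition acts_freely_on_hull :: "('a, 'b) monoid_scheme \<Rightarrow> 'a topology \<Rightarrow> 'a set \<Rightarrow> bool"
  where "acts_freely_on_hull G X Q \<longleftrightarrow>
    (\<forall>g\<in>carrier G. \<forall>R\<in>orbit_hull G X Q. translate G g R = R \<longrightarrow> g = \<one>\<^bsub>G\<^esub>)"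

definition borel_algebra :: "'a topology \<Rightarrow> 'a measure"
  where "borel_algebra X = sigma (topspace X) {U. openin X U}"

definition invariant_prob_on_hull ::
    "('a, 'b) monoid_scheme \<Rightarrow> 'a topology \<Rightarrow> 'a set \<Rightarrow> 'a set measure \<Rightarrow> bool"
  where "invariant_prob_on_hull G X Q M \<longleftrightarrow>
    prob_space M \<and>
    sets M = sets (borel_algebra (subtopology (chabauty_fell X) (orbit_hull G X Q))) \<and>
    (\<forall>g\<in>carrier G. distr M M (translate G g) = M)"

definition quasimorphism :: "('a, 'b) monoid_scheme \<Rightarrow> ('a \<Rightarrow> real) \<Rightarrow> bool"
  where "quasimorphism G \<phi> \<longleftrightarrow>
    (\<exists>D. \<forall>g\<in>carrier G. \<forall>h\<in>carrier G. \<bar>\<phi> (g \<otimes>\<^bsub>G\<^esub> h) - \<phi> g - \<phi> h\<bar> \<le> D)"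

definition bounded_distance :: "('a, 'b) monoid_scheme \<Rightarrow> ('a \<Rightarrow> real) \<Rightarrow> ('a \<Rightarrow> real) \<Rightarrow> bool"
  where "bounded_distance G \<phi> \<psi> \<longleftrightarrow> (\<exists>D. \<forall>g\<in>carrier G. \<bar>\<phi> g - \<psi> g\<bar> \<le> D)"

definition twist :: "('a, 'b) monoid_scheme \<Rightarrow> ('a \<Rightarrow> real) \<Rightarrow> real set \<Rightarrow> ('a \<times> real) set"
  where "twist G \<phi> P = {(\<gamma>, t). \<gamma> \<in> carrier G \<and> \<phi> \<gamma> + t \<in> P}"

lemma closedin_twist:
  assumes "closed P"
  shows "closedin (prod_topology (discrete_topology (carrier G)) euclideanreal) (twist G \<phi> P)"
proof -
  let ?D = "discrete_topology (carrier G)"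
  have "continuous_map (prod_topology ?D euclideanreal) euclideanreal (\<phi> \<circ> fst)"
    by (rule continuous_map_compose [OF continuous_map_fst]) auto
  then have "continuous_map (prod_topology ?D euclideanreal) euclideanreal
      (\<lambda>p. \<phi> (fst p) + snd p)"
    by (auto intro!: continuous_map_add continuous_map_snd simp: o_def)
  then have "closedin (prod_topology ?D euclideanreal)
      {p \<in> topspace (prod_topology ?D euclideanreal). \<phi> (fst p) + snd p \<in> P}"
    by (rule closedin_continuous_map_preimage) (use assms in simp)
  moreover have "{p \<in> topspace (prod_topology ?D euclideanreal). \<phi> (fst p) + snd p \<in> P}
      = twist G \<phi> P"
    by (auto simp: twist_def)
  ultimately show ?thesis
    by simp
qed

end

theory Submission
  imports Defs
begin

text \<open>
  A quasimorphism \<open>\<phi>\<close> is turned into a homomorphism by averaging a cocycle over the hull. Write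
  \<open>Q\<^sub>\<gamma>\<close> for the fibre of \<open>Q \<subseteq> \<Gamma> \<times> \<real>\<close> over \<open>\<gamma>\<close>. The fibres of the twisted set are the translates
  \<open>P - \<phi> \<gamma>\<close>, so for every \<open>Q\<close> in the orbit of the twisted set, say the translate by \<open>(g, s)\<close>, one has
  \<open>Q\<^sub>\<gamma> = Q\<^sub>e - c\<close> with \<open>c = \<phi> (\<gamma> g) - \<phi> g\<close>, a number within the defect \<open>D\<close> of \<open>\<phi> \<gamma>\<close>. For a compact
  set \<open>K\<close> of parameters, the relation ``\<open>B = A - c\<close> for some \<open>c \<in> K\<close>'' is closed in the
  Chabauty--Fell topology (\<open>closedin_translates_by_compact\<close>), and taking fibres is continuous
  because \<open>\<Gamma>\<close> is discrete (\<open>continuous_map_fibre\<close>). Hence every \<open>Q\<close> in the hull satisfies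
  \<open>Q\<^sub>\<gamma> = Q\<^sub>e - c\<close> for some \<open>c\<close> with \<open>\<bar>c - \<phi> \<gamma>\<bar> \<le> D\<close>.

  The fibre \<open>Q\<^sub>e\<close> lies in the hull of \<open>P\<close>, on which \<open>\<real>\<close> acts freely, so \<open>c = c(\<gamma>, Q)\<close> is unique; it
  obeys \<open>c(\<gamma>, g.Q) = c(\<gamma> g, Q) - c(g, Q)\<close>. The same closed relation, with smaller \<open>K\<close>, makes
  \<open>c(\<gamma>, \<cdot>)\<close> Borel. If \<open>\<mu>\<close> is an invariant probability measure on the hull, then
  \<open>\<psi> \<gamma> = \<integral> c(\<gamma>, Q) d\<mu>(Q)\<close> is additive by the cocycle identity and invariance, and
  \<open>\<bar>\<psi> \<gamma> - \<phi> \<gamma>\<bar> \<le> D\<close>: a homomorphism at bounded distance from \<open>\<phi>\<close>.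
\<close>

section \<open>The Chabauty--Fell topology\<close>

lemma openin_chabauty_fell_miss:
  "compactin X K \<Longrightarrow> openin (chabauty_fell X) {C. closedin X C \<and> C \<inter> K = {}}"
  unfolding chabauty_fell_def by (rule topology_generated_by_Basis) blast

lemma openin_chabauty_fell_hit:
  "openin X U \<Longrightarrow> openin (chabauty_fell X) {C. closedin X C \<and> C \<inter> U \<noteq> {}}"
  unfolding chabauty_fell_def by (rule topology_generated_by_Basis) blast

lemma continuous_map_into_chabauty_fell:
  assumes closed: "\<And>x. x \<in> topspace Z \<Longrightarrow> closedin X (f x)"
    and miss: "\<And>K. compactin X K \<Longrightarrow> openin Z {x \<in> topspace Z. f x \<inter> K = {}}"
    and hit: "\<And>U. openin X U \<Longrightarrow> openin Z {x \<in> topspace Z. f x \<inter> U \<noteq> {}}"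
  shows "continuous_map Z (chabauty_fell X) f"
  unfolding chabauty_fell_def continuous_on_generated_topo_iff
proof (intro conjI allI impI)
  fix U assume "U \<in> {{C. closedin X C \<and> C \<inter> K = {}} | K. compactin X K} \<union>
     {{C. closedin X C \<and> C \<inter> U \<noteq> {}} | U. openin X U}"
  then consider K where "compactin X K" "U = {C. closedin X C \<and> C \<inter> K = {}}"
    | V where "openin X V" "U = {C. closedin X C \<and> C \<inter> V \<noteq> {}}"
    by blast
  then show "openin Z (f -` U \<inter> topspace Z)"
  proof cases
    case 1
    then have "f -` U \<inter> topspace Z = {x \<in> topspace Z. f x \<inter> K = {}}"
      using closed by auto
    then show ?thesis using miss 1 by simp
  next
    case 2
    then have "f -` U \<inter> topspace Z = {x \<in> topspace Z. f x \<inter> V \<noteq> {}}"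
      using closed by auto
    then show ?thesis using hit 2 by simp
  qed
next
  show "f ` topspace Z \<subseteq> \<Union> ({{C. closedin X C \<and> C \<inter> K = {}} | K. compactin X K} \<union>
     {{C. closedin X C \<and> C \<inter> U \<noteq> {}} | U. openin X U})"
    using closed topspace_chabauty_fell [of X]
    unfolding chabauty_fell_def topology_generated_by_topspace by (auto simp only:)
qed

lemma continuous_map_chabauty_fell_image:
  assumes "homeomorphic_map X Y f"
  shows "continuous_map (chabauty_fell X) (chabauty_fell Y) (image f)"
proof -
  from assms obtain g where fg: "homeomorphic_maps X Y f g"
    by (auto simp: homeomorphic_map_maps)
  then have f: "continuous_map X Y f" and g: "continuous_map Y X g"
    and gf: "\<And>x. x \<in> topspace X \<Longrightarrow> g (f x) = x" and fg': "\<And>y. y \<in> topspace Y \<Longrightarrow> f (g y) = y"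
    by (auto simp: homeomorphic_maps_def)
  show ?thesis
  proof (rule continuous_map_into_chabauty_fell)
    fix C assume "C \<in> topspace (chabauty_fell X)"
    then show "closedin Y (f ` C)"
      using homeomorphic_imp_closed_map [OF assms]
      by (auto simp: topspace_chabauty_fell closed_map_def)
  next
    fix K assume K: "compactin Y K"
    then have KY: "K \<subseteq> topspace Y"
      by (rule compactin_subset_topspace)
    have "compactin X (g ` K)"
      using K g by (rule image_compactin)
    then have "openin (chabauty_fell X) {C. closedin X C \<and> C \<inter> g ` K = {}}"
      by (rule openin_chabauty_fell_miss)
    moreover have "f ` C \<inter> K = {} \<longleftrightarrow> C \<inter> g ` K = {}" if "closedin X C" for C
    proof -
      have "x \<in> g ` K \<longleftrightarrow> f x \<in> K" if "x \<in> C" for x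
      proof -
        have "g (f x) = x"
          using closedin_subset [OF \<open>closedin X C\<close>] that by (blast intro: gf)
        moreover have "f (g y) = y" if "y \<in> K" for y
          using that KY by (blast intro: fg')
        ultimately show ?thesis
          by (auto intro: rev_image_eqI)
      qed
      then show ?thesis by blast
    qed
    then have "{C \<in> topspace (chabauty_fell X). f ` C \<inter> K = {}} = {C. closedin X C \<and> C \<inter> g ` K = {}}"
      unfolding topspace_chabauty_fell mem_Collect_eq by (intro Collect_cong conj_cong refl)
    ultimately show "openin (chabauty_fell X) {C \<in> topspace (chabauty_fell X). f ` C \<inter> K = {}}"
      by (simp only:)
  next
    fix U assume U: "openin Y U"
    let ?V = "{x \<in> topspace X. f x \<in> U}"
    have "openin X ?V"
      using f U by (rule openin_continuous_map_preimage)
    then have "openin (chabauty_fell X) {C. closedin X C \<and> C \<inter> ?V \<noteq> {}}"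
      by (rule openin_chabauty_fell_hit)
    moreover have "f ` C \<inter> U \<noteq> {} \<longleftrightarrow> C \<inter> ?V \<noteq> {}" if "closedin X C" for C
      using closedin_subset [OF that] by blast
    then have "{C \<in> topspace (chabauty_fell X). f ` C \<inter> U \<noteq> {}} = {C. closedin X C \<and> C \<inter> ?V \<noteq> {}}"
      unfolding topspace_chabauty_fell mem_Collect_eq by (intro Collect_cong conj_cong refl)
    ultimately show "openin (chabauty_fell X) {C \<in> topspace (chabauty_fell X). f ` C \<inter> U \<noteq> {}}"
      by (simp only:)
  qed
qed

section \<open>Translates and hulls\<close>

lemma translate_translate:
  assumes "group G" "g \<in> carrier G" "h \<in> carrier G" "Q \<subseteq> carrier G"
  shows "translate G h (translate G g Q) = translate G (h \<otimes>\<^bsub>G\<^esub> g) Q"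
proof -
  interpret group G by fact
  show ?thesis
    unfolding translate_def image_image
    using assms by (intro image_cong refl) (auto simp: inv_mult_group m_assoc)
qed

lemma translate_real_group: "translate real_group c A = (\<lambda>x. x - c) ` A"
  by (simp add: translate_def)

lemma mem_translate_real_group: "x \<in> translate real_group c A \<longleftrightarrow> x + c \<in> A"
  by (force simp: translate_real_group image_iff)

lemma orbit_hull_subset_topspace: "orbit_hull G X Q \<subseteq> topspace (chabauty_fell X)"
  unfolding orbit_hull_def by (rule closure_of_subset_topspace)

lemma orbit_hull_subset_closedin:
  assumes "closedin (chabauty_fell X) \<C>"
    and "\<And>g. g \<in> carrier G \<Longrightarrow> translate G g Q \<in> \<C>"
  shows "orbit_hull G X Q \<subseteq> \<C>"
  unfolding orbit_hull_def using assms by (intro closure_of_minimal) auto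

lemma continuous_map_orbit_hull:
  assumes "continuous_map (chabauty_fell X) (chabauty_fell Y) F"
    and "\<And>g. g \<in> carrier G \<Longrightarrow> \<exists>h\<in>carrier H. F (translate G g Q) = translate H h R"
    and "C \<in> orbit_hull G X Q"
  shows "F C \<in> orbit_hull H Y R"
proof -
  have "F ` ((\<lambda>g. translate G g Q) ` carrier G) \<subseteq> (\<lambda>h. translate H h R) ` carrier H"
    using assms(2) by (force simp: image_iff)
  then have "chabauty_fell Y closure_of F ` ((\<lambda>g. translate G g Q) ` carrier G)
      \<subseteq> orbit_hull H Y R"
    unfolding orbit_hull_def by (rule closure_of_mono)
  with continuous_map_image_closure_subset [OF assms(1), of "(\<lambda>g. translate G g Q) ` carrier G"]
    assms(3)
  show ?thesis
    unfolding orbit_hull_def by blast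
qed

lemma translate_mem_orbit_hull:
  assumes "group G" "Q \<subseteq> carrier G" "h \<in> carrier G"
    and "continuous_map (chabauty_fell X) (chabauty_fell X) (translate G h)"
    and "C \<in> orbit_hull G X Q"
  shows "translate G h C \<in> orbit_hull G X Q"
proof (rule continuous_map_orbit_hull [OF assms(4) _ assms(5)])
  interpret group G by fact
  show "\<exists>k\<in>carrier G. translate G h (translate G g Q) = translate G k Q" if "g \<in> carrier G" for g
    using that assms by (intro bexI [of _ "h \<otimes>\<^bsub>G\<^esub> g"]) (auto simp: translate_translate)
qed

lemma translate_real_group_inj_on_free_hull:
  assumes "acts_freely_on_hull real_group X P" "A \<in> orbit_hull real_group X P"
    and "translate real_group c A = translate real_group d A"
  shows "c = d"
proof -
  have "translate real_group (c - d) A = A"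
  proof (rule Set.set_eqI)
    fix x
    have "x \<in> translate real_group (c - d) A \<longleftrightarrow> x - d \<in> translate real_group c A"
      by (simp add: mem_translate_real_group algebra_simps)
    also have "\<dots> \<longleftrightarrow> x \<in> A"
      by (simp add: assms(3) mem_translate_real_group)
    finally show "x \<in> translate real_group (c - d) A \<longleftrightarrow> x \<in> A" .
  qed
  with assms(1,2) have "c - d = \<one>\<^bsub>real_group\<^esub>"
    unfolding acts_freely_on_hull_def by (metis UNIV_I real_group_simps(1))
  then show ?thesis by simp
qed

section \<open>Closedness of the translation relation on the line\<close>

text \<open>If \<open>B \<noteq> A - c\<close>, some point lies in one of the closed sets \<open>B\<close>, \<open>A - c\<close> and a ball of radius
  \<open>e\<close> about it misses the other. The two sets stay different as long as the first meets the
  concentric ball of radius \<open>e / 2\<close>, the second misses the ball of radius \<open>e\<close>, and \<open>c\<close> moves by less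
  than \<open>e / 2\<close>; these conditions define a neighbourhood of \<open>((A, B), c)\<close>.\<close>

lemma closedin_translation_graph:
  "closedin (prod_topology (prod_topology (chabauty_fell euclideanreal) (chabauty_fell euclideanreal))
      euclideanreal)
    {((A, B), c). closed A \<and> closed B \<and> B = translate real_group c A}"
  (is "closedin ?Z ?W")
proof -
  have "\<exists>T. openin ?Z T \<and> z \<in> T \<and> T \<subseteq> topspace ?Z - ?W" if "z \<in> topspace ?Z - ?W" for z
  proof -
    obtain A B c where z: "z = ((A, B), c)"
      by (metis prod.exhaust)
    with that have A: "closed A" and B: "closed B" and ne: "B \<noteq> translate real_group c A"
      by (auto simp: topspace_chabauty_fell)
    from ne consider b where "b \<in> B" "b + c \<notin> A" | b where "b + c \<in> A" "b \<notin> B"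
      by (auto simp: set_eq_iff mem_translate_real_group)
    then show ?thesis
    proof cases
      case 1
      obtain e where e: "e > 0" "cball (b + c) e \<subseteq> - A"
        using 1 A by (metis ComplI open_Compl open_contains_cball)
      let ?T = "({C. closedin euclideanreal C \<and> C \<inter> cball (b + c) e = {}} \<times>
        {C. closedin euclideanreal C \<and> C \<inter> ball b (e / 2) \<noteq> {}}) \<times> ball c (e / 2)"
      have "openin ?Z ?T"
        using openin_chabauty_fell_miss [of euclideanreal "cball (b + c) e"]
          openin_chabauty_fell_hit [of euclideanreal "ball b (e / 2)"]
        by (simp add: openin_prod_Times_iff)
      moreover have "z \<in> ?T"
        using 1 A B e by (auto simp: z intro!: exI [of _ b])
      moreover have "?T \<subseteq> topspace ?Z - ?W"
      proof -
        have disjoint: False if "A' \<inter> cball (b + c) e = {}" "y \<in> translate real_group c' A'"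
          "y \<in> ball b (e / 2)" "c' \<in> ball c (e / 2)" for A' y c'
        proof -
          have "y + c' \<in> cball (b + c) e"
            using that(3,4) unfolding mem_ball mem_cball dist_real_def by linarith
          with that(1,2) show False
            by (auto simp: mem_translate_real_group)
        qed
        show ?thesis
        proof
          fix w assume "w \<in> ?T"
          moreover obtain A' B' c' where w: "w = ((A', B'), c')"
            by (metis prod.exhaust)
          ultimately have "closed A'" "closed B'" "A' \<inter> cball (b + c) e = {}"
            "B' \<inter> ball b (e / 2) \<noteq> {}" "c' \<in> ball c (e / 2)"
            by simp_all
          moreover from this obtain y where "y \<in> B'" "y \<in> ball b (e / 2)"
            by blast
          ultimately show "w \<in> topspace ?Z - ?W"
            using disjoint [of A' y c'] by (auto simp: w topspace_chabauty_fell)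
        qed
      qed
      ultimately show ?thesis by blast
    next
      case 2
      obtain e where e: "e > 0" "cball b e \<subseteq> - B"
        using 2 B by (metis ComplI open_Compl open_contains_cball)
      let ?T = "({C. closedin euclideanreal C \<and> C \<inter> ball (b + c) (e / 2) \<noteq> {}} \<times>
        {C. closedin euclideanreal C \<and> C \<inter> cball b e = {}}) \<times> ball c (e / 2)"
      have "openin ?Z ?T"
        using openin_chabauty_fell_miss [of euclideanreal "cball b e"]
          openin_chabauty_fell_hit [of euclideanreal "ball (b + c) (e / 2)"]
        by (simp add: openin_prod_Times_iff)
      moreover have "z \<in> ?T"
        using 2 A B e by (auto simp: z intro!: exI [of _ "b + c"])
      moreover have "?T \<subseteq> topspace ?Z - ?W"
      proof -
        have disjoint: False if "translate real_group c' A' \<inter> cball b e = {}" "y \<in> A'"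
          "y \<in> ball (b + c) (e / 2)" "c' \<in> ball c (e / 2)" for A' y c'
        proof -
          have "y - c' \<in> cball b e"
            using that(3,4) unfolding mem_ball mem_cball dist_real_def by linarith
          moreover have "y - c' \<in> translate real_group c' A'"
            using that(2) by (simp add: mem_translate_real_group)
          ultimately show False
            using that(1) by blast
        qed
        show ?thesis
        proof
          fix w assume "w \<in> ?T"
          moreover obtain A' B' c' where w: "w = ((A', B'), c')"
            by (metis prod.exhaust)
          ultimately have "closed A'" "closed B'" "B' \<inter> cball b e = {}"
            "A' \<inter> ball (b + c) (e / 2) \<noteq> {}" "c' \<in> ball c (e / 2)"
            by simp_all
          moreover from this obtain y where "y \<in> A'" "y \<in> ball (b + c) (e / 2)"
            by blast
          ultimately show "w \<in> topspace ?Z - ?W"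
            using disjoint [of c' A' y] by (auto simp: w topspace_chabauty_fell)
        qed
      qed
      ultimately show ?thesis by blast
    qed
  qed
  then have "openin ?Z (topspace ?Z - ?W)"
    by (subst openin_subopen) blast
  then show ?thesis
    by (auto simp: closedin_def topspace_chabauty_fell)
qed

text \<open>Compactness of \<open>K\<close> makes the projection that forgets the translation parameter a closed
  map.\<close>

lemma closedin_translates_by_compact:
  assumes "compact K"
  shows "closedin (prod_topology (chabauty_fell euclideanreal) (chabauty_fell euclideanreal))
    {(A, B). closed A \<and> closed B \<and> (\<exists>c\<in>K. B = translate real_group c A)}"
    (is "closedin ?Y ?R")
proof -
  let ?W = "{((A, B), c). closed A \<and> closed B \<and> B = translate real_group c A}"
  let ?K = "subtopology euclideanreal K"
  have "closedin (prod_topology ?Y ?K) (?W \<inter> topspace ?Y \<times> K)"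
    unfolding prod_topology_subtopology closedin_subtopology
    using closedin_translation_graph by blast
  moreover have "compact_space ?K"
    using assms by (simp add: compact_space_subtopology)
  ultimately have "closedin ?Y (fst ` (?W \<inter> topspace ?Y \<times> K))"
    using Abstract_Topological_Spaces.closed_map_fst unfolding closed_map_def by blast
  moreover have "fst ` (?W \<inter> topspace ?Y \<times> K) = ?R"
  proof (intro equalityI subsetI)
    fix p assume "p \<in> ?R"
    then obtain A B c where "p = (A, B)" "closed A" "closed B" "c \<in> K" "B = translate real_group c A"
      by blast
    then have "p = fst ((A, B), c)" "((A, B), c) \<in> ?W \<inter> topspace ?Y \<times> K"
      by (simp_all add: topspace_chabauty_fell)
    then show "p \<in> fst ` (?W \<inter> topspace ?Y \<times> K)"
      by (rule image_eqI)
  qed auto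
  ultimately show ?thesis by simp
qed

section \<open>Fibres over a discrete factor\<close>

text \<open>The fibre of \<open>Q \<subseteq> \<Gamma> \<times> \<real>\<close> over the point \<open>\<gamma>\<close> of \<open>\<Gamma>\<close>.\<close>

definition fibre :: "'a \<Rightarrow> ('a \<times> real) set \<Rightarrow> real set"
  where "fibre \<gamma> Q = {t. (\<gamma>, t) \<in> Q}"

lemma continuous_map_fibre:
  assumes "\<gamma> \<in> S"
  shows "continuous_map (chabauty_fell (prod_topology (discrete_topology S) euclideanreal))
    (chabauty_fell euclideanreal) (fibre \<gamma>)"
    (is "continuous_map (chabauty_fell ?X) _ _")
proof (rule continuous_map_into_chabauty_fell)
  fix Q assume "Q \<in> topspace (chabauty_fell ?X)"
  then have Q: "closedin ?X Q"
    by (simp add: topspace_chabauty_fell)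
  have "continuous_map euclideanreal ?X (\<lambda>t. (\<gamma>, t))"
    using assms by (auto intro!: continuous_map_pairedI)
  then have "closedin euclideanreal {t \<in> topspace euclideanreal. (\<gamma>, t) \<in> Q}"
    using Q by (rule closedin_continuous_map_preimage)
  then show "closedin euclideanreal (fibre \<gamma> Q)"
    by (simp add: fibre_def)
next
  fix K assume "compactin euclideanreal K"
  then have "compactin ?X ({\<gamma>} \<times> K)"
    using assms by (simp add: compactin_Times)
  moreover have "fibre \<gamma> Q \<inter> K = {} \<longleftrightarrow> Q \<inter> {\<gamma>} \<times> K = {}" for Q
    by (auto simp: fibre_def)
  ultimately show "openin (chabauty_fell ?X) {Q \<in> topspace (chabauty_fell ?X). fibre \<gamma> Q \<inter> K = {}}"
    using openin_chabauty_fell_miss [of ?X "{\<gamma>} \<times> K"] by (simp add: topspace_chabauty_fell)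
next
  fix U assume "openin euclideanreal U"
  then have "openin ?X ({\<gamma>} \<times> U)"
    using assms by (simp add: openin_prod_Times_iff)
  moreover have "fibre \<gamma> Q \<inter> U \<noteq> {} \<longleftrightarrow> Q \<inter> {\<gamma>} \<times> U \<noteq> {}" for Q
    by (auto simp: fibre_def)
  ultimately show "openin (chabauty_fell ?X) {Q \<in> topspace (chabauty_fell ?X). fibre \<gamma> Q \<inter> U \<noteq> {}}"
    using openin_chabauty_fell_hit [of ?X "{\<gamma>} \<times> U"] by (simp add: topspace_chabauty_fell)
qed

lemma closedin_fibres_translates_by_compact:
  assumes "\<gamma> \<in> S" "\<delta> \<in> S" "compact K"
  defines "X \<equiv> prod_topology (discrete_topology S) euclideanreal"
  shows "closedin (chabauty_fell X)
    {Q. closedin X Q \<and> (\<exists>c\<in>K. fibre \<gamma> Q = translate real_group c (fibre \<delta> Q))}"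
proof -
  let ?F = "chabauty_fell euclideanreal"
  have \<gamma>: "continuous_map (chabauty_fell X) ?F (fibre \<gamma>)"
    and \<delta>: "continuous_map (chabauty_fell X) ?F (fibre \<delta>)"
    unfolding X_def using assms by (auto intro: continuous_map_fibre)
  then have "continuous_map (chabauty_fell X) (prod_topology ?F ?F) (\<lambda>Q. (fibre \<delta> Q, fibre \<gamma> Q))"
    by (intro continuous_map_pairedI)
  from closedin_continuous_map_preimage [OF this closedin_translates_by_compact [OF assms(3)]]
  have "closedin (chabauty_fell X) {Q. closedin X Q \<and> closed (fibre \<delta> Q) \<and> closed (fibre \<gamma> Q) \<and>
      (\<exists>c\<in>K. fibre \<gamma> Q = translate real_group c (fibre \<delta> Q))}"
    by (simp add: topspace_chabauty_fell)
  moreover have "closed (fibre \<delta> Q) \<and> closed (fibre \<gamma> Q)" if "closedin X Q" for Q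
    using that \<gamma> \<delta> by (auto simp: continuous_map_def topspace_chabauty_fell Pi_iff)
  ultimately show ?thesis
    by (simp cong: conj_cong)
qed

lemma translate_DirProd_real:
  assumes "group \<Gamma>" "g \<in> carrier \<Gamma>"
  shows "translate (\<Gamma> \<times>\<times> real_group) (g, s) = image (\<lambda>(\<gamma>, t). (\<gamma> \<otimes>\<^bsub>\<Gamma>\<^esub> inv\<^bsub>\<Gamma>\<^esub> g, t - s))"
proof
  fix Q
  have "inv\<^bsub>\<Gamma> \<times>\<times> real_group\<^esub> (g, s) = (inv\<^bsub>\<Gamma>\<^esub> g, - s)"
    using assms by simp
  then show "translate (\<Gamma> \<times>\<times> real_group) (g, s) Q = (\<lambda>(\<gamma>, t). (\<gamma> \<otimes>\<^bsub>\<Gamma>\<^esub> inv\<^bsub>\<Gamma>\<^esub> g, t - s)) ` Q"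
    by (simp add: translate_def DirProd_def case_prod_unfold)
qed

lemma homeomorphic_map_right_mult:
  assumes "group \<Gamma>" "g \<in> carrier \<Gamma>"
  defines "X \<equiv> prod_topology (discrete_topology (carrier \<Gamma>)) euclideanreal"
  shows "homeomorphic_map X X (\<lambda>(\<gamma>, t). (\<gamma> \<otimes>\<^bsub>\<Gamma>\<^esub> inv\<^bsub>\<Gamma>\<^esub> g, t - s))"
proof -
  interpret group \<Gamma> by fact
  have "homeomorphic_maps X X (\<lambda>(\<gamma>, t). (\<gamma> \<otimes>\<^bsub>\<Gamma>\<^esub> inv\<^bsub>\<Gamma>\<^esub> g, t - s)) (\<lambda>(\<gamma>, t). (\<gamma> \<otimes>\<^bsub>\<Gamma>\<^esub> g, t + s))"
    unfolding homeomorphic_maps_def X_def using assms(2)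
    by (auto simp: continuous_map_prod_top m_assoc intro!: continuous_intros)
  then show ?thesis
    by (auto simp: homeomorphic_map_maps)
qed

lemma continuous_map_translate_DirProd_real:
  assumes "group \<Gamma>" "g \<in> carrier \<Gamma>"
  defines "X \<equiv> prod_topology (discrete_topology (carrier \<Gamma>)) euclideanreal"
  shows "continuous_map (chabauty_fell X) (chabauty_fell X) (translate (\<Gamma> \<times>\<times> real_group) (g, s))"
  unfolding translate_DirProd_real [OF assms(1,2)] X_def
  using assms by (intro continuous_map_chabauty_fell_image homeomorphic_map_right_mult)

lemma fibre_translate:
  assumes "group \<Gamma>" "g \<in> carrier \<Gamma>" "\<gamma> \<in> carrier \<Gamma>" "Q \<subseteq> carrier \<Gamma> \<times> UNIV"
  shows "fibre \<gamma> (translate (\<Gamma> \<times>\<times> real_group) (g, s) Q) = translate real_group s (fibre (\<gamma> \<otimes>\<^bsub>\<Gamma>\<^esub> g) Q)"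
proof (rule Set.set_eqI)
  interpret group \<Gamma> by fact
  fix x
  have "(\<gamma>, x) \<in> translate (\<Gamma> \<times>\<times> real_group) (g, s) Q \<longleftrightarrow>
      (\<exists>\<delta> t. (\<delta>, t) \<in> Q \<and> \<gamma> = \<delta> \<otimes>\<^bsub>\<Gamma>\<^esub> inv\<^bsub>\<Gamma>\<^esub> g \<and> x = t - s)"
    by (force simp: translate_DirProd_real [OF assms(1,2)])
  also have "\<dots> \<longleftrightarrow> (\<exists>\<delta> t. (\<delta>, t) \<in> Q \<and> \<gamma> \<otimes>\<^bsub>\<Gamma>\<^esub> g = \<delta> \<and> x + s = t)"
    using assms(2-4) by (intro ex_cong1 conj_cong refl) (auto simp: m_assoc)
  also have "\<dots> \<longleftrightarrow> (\<gamma> \<otimes>\<^bsub>\<Gamma>\<^esub> g, x + s) \<in> Q"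
    by simp
  finally show "x \<in> fibre \<gamma> (translate (\<Gamma> \<times>\<times> real_group) (g, s) Q) \<longleftrightarrow>
      x \<in> translate real_group s (fibre (\<gamma> \<otimes>\<^bsub>\<Gamma>\<^esub> g) Q)"
    by (simp add: fibre_def mem_translate_real_group)
qed

lemma fibre_twist: "\<gamma> \<in> carrier \<Gamma> \<Longrightarrow> fibre \<gamma> (twist \<Gamma> \<phi> P) = translate real_group (\<phi> \<gamma>) P"
  by (auto simp: fibre_def twist_def mem_translate_real_group add.commute)

section \<open>Borel structure of a hull\<close>

lemma sets_borel_algebra: "sets (borel_algebra X) = sigma_sets (topspace X) {U. openin X U}"
  unfolding borel_algebra_def by (rule sets_measure_of) (auto dest: openin_subset)

lemma space_borel_algebra: "space (borel_algebra X) = topspace X"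
  unfolding borel_algebra_def by (rule space_measure_of) (auto dest: openin_subset)

lemma closedin_sets_borel_algebra:
  assumes "closedin X C"
  shows "C \<in> sets (borel_algebra X)"
proof -
  have "topspace X - C \<in> sets (borel_algebra X)"
    using assms by (auto simp: sets_borel_algebra closedin_def)
  then have "space (borel_algebra X) - (topspace X - C) \<in> sets (borel_algebra X)"
    by (rule sets.compl_sets)
  then show ?thesis
    using closedin_subset [OF assms] by (simp add: space_borel_algebra double_diff)
qed

lemma continuous_map_measurable_borel_algebra:
  assumes "continuous_map X Y f"
  shows "f \<in> measurable (borel_algebra X) (borel_algebra Y)"
  unfolding borel_algebra_def [of Y]
proof (rule measurable_measure_of)
  show "f \<in> space (borel_algebra X) \<rightarrow> topspace Y"
    using assms by (auto simp: space_borel_algebra continuous_map_def)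
  fix U assume "U \<in> {U. openin Y U}"
  then have "openin X {x \<in> topspace X. f x \<in> U}"
    using assms openin_continuous_map_preimage by blast
  moreover have "f -` U \<inter> space (borel_algebra X) = {x \<in> topspace X. f x \<in> U}"
    by (auto simp: space_borel_algebra)
  ultimately show "f -` U \<inter> space (borel_algebra X) \<in> sets (borel_algebra X)"
    by (simp add: sets_borel_algebra)
qed (auto dest: openin_subset)

section \<open>The cocycle of a twisted set and its mean\<close>

theorem proposition1p2:
  fixes \<Gamma> :: "('a, 'b) monoid_scheme" and P :: "real set" and \<phi> :: "'a \<Rightarrow> real"
  assumes "group \<Gamma>" and "countable (carrier \<Gamma>)"
    and "closed P"
    and "acts_freely_on_hull real_group euclideanreal P"
    and "quasimorphism \<Gamma> \<phi>"
    and "\<phi> \<one>\<^bsub>\<Gamma>\<^esub> = 0"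
    and "\<not> (\<exists>\<psi>\<in>hom \<Gamma> real_group. bounded_distance \<Gamma> \<phi> \<psi>)"
  shows "\<not> (\<exists>M. invariant_prob_on_hull (\<Gamma> \<times>\<times> real_group)
            (prod_topology (discrete_topology (carrier \<Gamma>)) euclideanreal)
            (twist \<Gamma> \<phi> P) M)"
proof
  let ?G = "\<Gamma> \<times>\<times> real_group"
  let ?X = "prod_topology (discrete_topology (carrier \<Gamma>)) euclideanreal"
  let ?T = "twist \<Gamma> \<phi> P"
  define \<Omega> where "\<Omega> = orbit_hull ?G ?X ?T"
  let ?\<Omega> = "subtopology (chabauty_fell ?X) \<Omega>"
  assume "\<exists>M. invariant_prob_on_hull ?G ?X ?T M"
  then obtain M where M: "invariant_prob_on_hull ?G ?X ?T M" ..
  interpret \<Gamma>: group \<Gamma> by fact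
  interpret prob_space M
    using M by (simp add: invariant_prob_on_hull_def)
  have sets_M: "sets M = sets (borel_algebra ?\<Omega>)"
    and invariant: "\<And>g s. g \<in> carrier \<Gamma> \<Longrightarrow> distr M M (translate ?G (g, s)) = M"
    using M by (auto simp: invariant_prob_on_hull_def \<Omega>_def DirProd_def)
  obtain D where D: "\<And>g h. g \<in> carrier \<Gamma> \<Longrightarrow> h \<in> carrier \<Gamma> \<Longrightarrow> \<bar>\<phi> (g \<otimes>\<^bsub>\<Gamma>\<^esub> h) - \<phi> g - \<phi> h\<bar> \<le> D"
    using assms(5) by (auto simp: quasimorphism_def)
  have group_G: "group ?G"
    using assms(1) by (simp add: DirProd_group)
  have T_sub: "?T \<subseteq> carrier \<Gamma> \<times> UNIV"
    by (auto simp: twist_def)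
  have \<Omega>_closedin: "closedin ?X Q" if "Q \<in> \<Omega>" for Q
    using that orbit_hull_subset_topspace by (fastforce simp: \<Omega>_def topspace_chabauty_fell)
  have \<Omega>_sub: "Q \<subseteq> carrier \<Gamma> \<times> UNIV" if "Q \<in> \<Omega>" for Q
    using closedin_subset [OF \<Omega>_closedin [OF that]] by simp
  have topspace_\<Omega>: "topspace ?\<Omega> = \<Omega>"
    using \<Omega>_closedin by (auto simp: topspace_chabauty_fell)
  have space_M: "space M = \<Omega>"
    using sets_eq_imp_space_eq [OF sets_M] by (simp only: space_borel_algebra topspace_\<Omega>)

  have translate_\<Omega>: "translate ?G (g, s) Q \<in> \<Omega>" if "g \<in> carrier \<Gamma>" "Q \<in> \<Omega>" for g s Q
    unfolding \<Omega>_def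
  proof (rule translate_mem_orbit_hull [OF group_G])
    show "continuous_map (chabauty_fell ?X) (chabauty_fell ?X) (translate ?G (g, s))"
      using assms(1) that(1) by (rule continuous_map_translate_DirProd_real)
  qed (use that T_sub in \<open>auto simp: DirProd_def \<Omega>_def\<close>)
  have translate_measurable: "translate ?G (g, s) \<in> measurable M M" if g: "g \<in> carrier \<Gamma>" for g s
  proof -
    have "continuous_map ?\<Omega> ?\<Omega> (translate ?G (g, s))"
      using continuous_map_translate_DirProd_real [OF assms(1) g, of s] translate_\<Omega> [OF g]
      by (auto simp: continuous_map_in_subtopology topspace_\<Omega> intro: continuous_map_from_subtopology)
    then have "translate ?G (g, s) \<in> measurable (borel_algebra ?\<Omega>) (borel_algebra ?\<Omega>)"
      by (rule continuous_map_measurable_borel_algebra)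
    then show ?thesis
      using measurable_cong_sets [OF sets_M sets_M] by simp
  qed

  have fibre_hull: "fibre \<one>\<^bsub>\<Gamma>\<^esub> Q \<in> orbit_hull real_group euclideanreal P" if "Q \<in> \<Omega>" for Q
  proof (rule continuous_map_orbit_hull [OF continuous_map_fibre])
    show "Q \<in> orbit_hull ?G (prod_topology (discrete_topology (carrier \<Gamma>)) euclideanreal) ?T"
      using that by (simp add: \<Omega>_def)
    show "\<exists>r\<in>carrier real_group. fibre \<one>\<^bsub>\<Gamma>\<^esub> (translate ?G h ?T) = translate real_group r P"
      if h: "h \<in> carrier ?G" for h
    proof -
      obtain g s where "h = (g, s)" "g \<in> carrier \<Gamma>"
        using h by (auto simp: DirProd_def)
      then show ?thesis
        using T_sub by (auto simp: fibre_translate fibre_twist translate_translate assms(1))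
    qed
  qed auto

  \<comment> \<open>Orbit elements satisfy this by the defect bound; the condition is closed because the
    parameter ranges over a compact interval, so it passes to the hull.\<close>
  have cocycle_ex: "\<exists>c\<in>{\<phi> \<gamma> - D..\<phi> \<gamma> + D}. fibre \<gamma> Q = translate real_group c (fibre \<one>\<^bsub>\<Gamma>\<^esub> Q)"
    if \<gamma>: "\<gamma> \<in> carrier \<Gamma>" and Q: "Q \<in> \<Omega>" for \<gamma> Q
  proof -
    let ?C = "{Q. closedin ?X Q \<and>
      (\<exists>c\<in>{\<phi> \<gamma> - D..\<phi> \<gamma> + D}. fibre \<gamma> Q = translate real_group c (fibre \<one>\<^bsub>\<Gamma>\<^esub> Q))}"
    have "\<Omega> \<subseteq> ?C"
      unfolding \<Omega>_def
    proof (rule orbit_hull_subset_closedin)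
      show "closedin (chabauty_fell ?X) ?C"
        using \<gamma> by (intro closedin_fibres_translates_by_compact) auto
      show "translate ?G h ?T \<in> ?C" if h: "h \<in> carrier ?G" for h
      proof -
        obtain g s where hg: "h = (g, s)" and g: "g \<in> carrier \<Gamma>"
          using h by (auto simp: DirProd_def)
        have "closedin ?X (translate ?G h ?T)"
          using continuous_map_translate_DirProd_real [OF assms(1) g, of s]
            closedin_twist [OF assms(3), of \<Gamma> \<phi>]
          by (auto simp: hg continuous_map_def topspace_chabauty_fell Pi_iff)
        moreover have "\<phi> (\<gamma> \<otimes>\<^bsub>\<Gamma>\<^esub> g) - \<phi> g \<in> {\<phi> \<gamma> - D..\<phi> \<gamma> + D}"
          using D [OF \<gamma> g] by (auto simp: abs_le_iff)
        moreover have "fibre \<gamma> (translate ?G h ?T) =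
            translate real_group (\<phi> (\<gamma> \<otimes>\<^bsub>\<Gamma>\<^esub> g) - \<phi> g) (fibre \<one>\<^bsub>\<Gamma>\<^esub> (translate ?G h ?T))"
          using \<gamma> g T_sub by (simp add: hg fibre_translate fibre_twist translate_translate assms(1) add.commute)
        ultimately show ?thesis by blast
      qed
    qed
    with Q show ?thesis by blast
  qed

  \<comment> \<open>Freeness makes the translation between two fibres unique.\<close>
  have cocycle_unique: "c = d"
    if "Q \<in> \<Omega>" "translate real_group c (fibre \<one>\<^bsub>\<Gamma>\<^esub> Q) = translate real_group d (fibre \<one>\<^bsub>\<Gamma>\<^esub> Q)"
    for Q c d
    using translate_real_group_inj_on_free_hull [OF assms(4) fibre_hull] that by blast

  define c where "c \<gamma> Q = (THE c. fibre \<gamma> Q = translate real_group c (fibre \<one>\<^bsub>\<Gamma>\<^esub> Q))" for \<gamma> Q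
  have c_eqI: "c \<gamma> Q = r"
    if "Q \<in> \<Omega>" "fibre \<gamma> Q = translate real_group r (fibre \<one>\<^bsub>\<Gamma>\<^esub> Q)" for \<gamma> Q r
    unfolding c_def using that cocycle_unique by (intro the_equality) auto
  have c: "fibre \<gamma> Q = translate real_group (c \<gamma> Q) (fibre \<one>\<^bsub>\<Gamma>\<^esub> Q)"
    and c_bounds: "c \<gamma> Q \<in> {\<phi> \<gamma> - D..\<phi> \<gamma> + D}" if "\<gamma> \<in> carrier \<Gamma>" "Q \<in> \<Omega>" for \<gamma> Q
    using cocycle_ex [OF that] c_eqI [OF that(2)] by auto

  have cocycle: "c \<gamma> (translate ?G (g, 0) Q) = c (\<gamma> \<otimes>\<^bsub>\<Gamma>\<^esub> g) Q - c g Q"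
    if \<gamma>: "\<gamma> \<in> carrier \<Gamma>" and g: "g \<in> carrier \<Gamma>" and Q: "Q \<in> \<Omega>" for \<gamma> g Q
  proof (rule c_eqI)
    show "translate ?G (g, 0) Q \<in> \<Omega>"
      using g Q by (rule translate_\<Omega>)
    show "fibre \<gamma> (translate ?G (g, 0) Q) =
        translate real_group (c (\<gamma> \<otimes>\<^bsub>\<Gamma>\<^esub> g) Q - c g Q) (fibre \<one>\<^bsub>\<Gamma>\<^esub> (translate ?G (g, 0) Q))"
      using \<gamma> g Q \<Omega>_sub [OF Q]
      by (simp add: fibre_translate assms(1) c [of "\<gamma> \<otimes>\<^bsub>\<Gamma>\<^esub> g" Q] c [of g Q] translate_translate)
  qed

  have c_measurable: "c \<gamma> \<in> borel_measurable M" if \<gamma>: "\<gamma> \<in> carrier \<Gamma>" for \<gamma>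
    unfolding borel_measurable_iff_le
  proof
    fix a
    \<comment> \<open>As \<open>c \<gamma>\<close> takes values in a compact interval, its sublevel sets are given by compact
      sets of parameters and are therefore closed in the hull.\<close>
    let ?K = "{\<phi> \<gamma> - D..min a (\<phi> \<gamma> + D)}"
    let ?C = "{Q. closedin ?X Q \<and> (\<exists>r\<in>?K. fibre \<gamma> Q = translate real_group r (fibre \<one>\<^bsub>\<Gamma>\<^esub> Q))}"
    have "closedin (chabauty_fell ?X) ?C"
      using \<gamma> by (intro closedin_fibres_translates_by_compact) auto
    then have "closedin ?\<Omega> (?C \<inter> \<Omega>)"
      unfolding closedin_subtopology by blast
    then have "?C \<inter> \<Omega> \<in> sets M"
      unfolding sets_M by (rule closedin_sets_borel_algebra)
    moreover have "{Q \<in> space M. c \<gamma> Q \<le> a} = ?C \<inter> \<Omega>"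
    proof (intro Set.set_eqI iffI)
      fix Q assume "Q \<in> {Q \<in> space M. c \<gamma> Q \<le> a}"
      then have Q: "Q \<in> \<Omega>" "c \<gamma> Q \<le> a"
        by (auto simp: space_M)
      moreover have "c \<gamma> Q \<in> ?K"
        using c_bounds [OF \<gamma> Q(1)] Q(2) by auto
      ultimately show "Q \<in> ?C \<inter> \<Omega>"
        using c [OF \<gamma> Q(1)] \<Omega>_closedin [OF Q(1)] by blast
    next
      fix Q assume "Q \<in> ?C \<inter> \<Omega>"
      then obtain r where "Q \<in> \<Omega>" "r \<in> ?K" "fibre \<gamma> Q = translate real_group r (fibre \<one>\<^bsub>\<Gamma>\<^esub> Q)"
        by blast
      then show "Q \<in> {Q \<in> space M. c \<gamma> Q \<le> a}"
        using c_eqI by (auto simp: space_M)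
    qed
    ultimately show "{Q \<in> space M. c \<gamma> Q \<le> a} \<in> sets M"
      by simp
  qed
  have c_integrable: "integrable M (c \<gamma>)" if \<gamma>: "\<gamma> \<in> carrier \<Gamma>" for \<gamma>
  proof (rule integrable_const_bound [where B = "\<bar>\<phi> \<gamma>\<bar> + D"])
    show "AE Q in M. norm (c \<gamma> Q) \<le> \<bar>\<phi> \<gamma>\<bar> + D"
    proof (rule AE_I2)
      fix Q assume "Q \<in> space M"
      then show "norm (c \<gamma> Q) \<le> \<bar>\<phi> \<gamma>\<bar> + D"
        using c_bounds [OF \<gamma>, of Q] by (auto simp: space_M)
    qed
  qed (rule c_measurable [OF \<gamma>])

  define \<psi> where "\<psi> \<gamma> = (\<integral>Q. c \<gamma> Q \<partial>M)" for \<gamma>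
  have "\<psi> (\<gamma> \<otimes>\<^bsub>\<Gamma>\<^esub> g) = \<psi> \<gamma> + \<psi> g" if \<gamma>: "\<gamma> \<in> carrier \<Gamma>" and g: "g \<in> carrier \<Gamma>" for \<gamma> g
  proof -
    have "\<psi> \<gamma> = (\<integral>Q. c \<gamma> Q \<partial>distr M M (translate ?G (g, 0)))"
      by (simp add: \<psi>_def invariant [OF g])
    also have "\<dots> = (\<integral>Q. c \<gamma> (translate ?G (g, 0) Q) \<partial>M)"
      using translate_measurable [OF g] c_measurable [OF \<gamma>] by (rule integral_distr)
    also have "\<dots> = (\<integral>Q. c (\<gamma> \<otimes>\<^bsub>\<Gamma>\<^esub> g) Q - c g Q \<partial>M)"
      using cocycle [OF \<gamma> g] by (intro Bochner_Integration.integral_cong) (auto simp: space_M)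
    also have "\<dots> = \<psi> (\<gamma> \<otimes>\<^bsub>\<Gamma>\<^esub> g) - \<psi> g"
      unfolding \<psi>_def using \<gamma> g by (intro Bochner_Integration.integral_diff c_integrable) auto
    finally show ?thesis by simp
  qed
  then have "\<psi> \<in> hom \<Gamma> real_group"
    by (simp add: hom_def)
  moreover have "bounded_distance \<Gamma> \<phi> \<psi>"
    unfolding bounded_distance_def
  proof (intro exI ballI)
    fix \<gamma> assume \<gamma>: "\<gamma> \<in> carrier \<Gamma>"
    have "\<psi> \<gamma> \<ge> \<phi> \<gamma> - D"
      unfolding \<psi>_def using c_bounds [OF \<gamma>]
      by (intro integral_ge_const c_integrable \<gamma> AE_I2) (auto simp: space_M)
    moreover have "\<psi> \<gamma> \<le> \<phi> \<gamma> + D"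
      unfolding \<psi>_def using c_bounds [OF \<gamma>]
      by (intro integral_le_const c_integrable \<gamma> AE_I2) (auto simp: space_M)
    ultimately show "\<bar>\<phi> \<gamma> - \<psi> \<gamma>\<bar> \<le> D"
      by (simp add: abs_le_iff)
  qed
  ultimately show False
    using assms(7) by blast
qed

end
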